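(* Let $2\le k\le n-2$. The polyhedron $\Pi_{k,n}$ has the following two properties: 1. $\Pi_{k,n}$ has exactly $\binom nk-n$ facets. 2. $\Pi_{k,n}$ has a unique interior lattice point $p_0$, given by $\alpha_{i,j}=0$ for all $(i,j)\in\{1,\ldots,k-1\}\times\{1,\ldots,n-k\}$.
   Context: Let $\alpha_{i,j}$, $1\le i\le k-1$, $1\le j\le n-k$, be the coordinates on $\mathbb{R}^{(k-1)\times(n-k)}$. Put $\alpha_{i,[a,b]}=\sum_{j=a}^b\alpha_{i,j}$, with $\alpha_{i,[a,b]}=0$ if $a>b$. Let $$\mathcal{H}_{k,n}=\Big\{(\alpha_{i,j})\in\mathbb{R}^{(k-1)\times(n-k)}:\ \sum_{j=1}^{n-k}\alpha_{i,j}=0\ \text{ for each } i=1,\ldots,k-1\Big\}.$$ A $k$-element subset of $\{1,\ldots,n\}$ is frozen if it is a cyclic interval $\{j,j+1,\ldots,j+k-1\}$ (modulo $n$), and nonfrozen otherwise; $\binom{[n]}{k}^{nf}$ denotes the set of nonfrozen $k$-element subsets. Define $$\Pi_{k,n}=\Big\{(\alpha_{i,j})\in\mathcal{H}_{k,n}:\ \sum_{i=1}^{k-1}\alpha_{i,[j_i-(i-1),\,j_{i+1}-i-1]}+1\ge0\ \text{ for all } J=\{j_1<\cdots<j_k\}\in\tbinom{[n]}{k}^{nf}\Big\}.$$ For example, for $J=\{1,3,6\}$ (with $k=3$) the inequality is $\alpha_{1,1}+\alpha_{2,2}+\alpha_{2,3}+1\ge0$. Interior and facets are taken relative to $\mathcal{H}_{k,n}$,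 and lattice points are points of $\mathcal{H}_{k,n}$ with integer coordinates. *)

theory Defs
  imports "HOL-Analysis.Analysis"
begin

text \<open>
  The space of (k-1) x (n-k) matrices is rendered as \<^typ>\<open>real ^ 'c ^ 'r\<close>, where
  \<open>\<rho>\<close> and \<open>\<kappa>\<close> are enumerations of the index types:
  \<open>\<rho>\<close> maps \<open>{1..k-1}\<close> bijectively onto the type \<open>'r\<close>, and \<open>\<kappa>\<close> maps \<open>{1..n-k}\<close> bijectively
  onto \<open>'c\<close>. The coordinate in position \<open>(i, j)\<close> is therefore \<open>\<alpha> $ \<rho> i $ \<kappa> j\<close>.
\<close>

definition row_sum ::
  "(nat \<Rightarrow> 'r) \<Rightarrow> (nat \<Rightarrow> 'c) \<Rightarrow> real ^ 'c::finite ^ 'r::finite \<Rightarrow> nat \<Rightarrow> nat \<Rightarrow> nat \<Rightarrow> real"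
  where "row_sum \<rho> \<kappa> \<alpha> i a b = (\<Sum>j = a..b. \<alpha> $ \<rho> i $ \<kappa> j)"

definition zero_row_space ::
  "nat \<Rightarrow> nat \<Rightarrow> (nat \<Rightarrow> 'r) \<Rightarrow> (nat \<Rightarrow> 'c) \<Rightarrow> (real ^ 'c::finite ^ 'r::finite) set"
  where "zero_row_space k n \<rho> \<kappa> =
    {\<alpha>. \<forall>i\<in>{1..k-1}. (\<Sum>j = 1..n-k. \<alpha> $ \<rho> i $ \<kappa> j) = 0}"

text \<open>The term \<open>(j - 1 + m) mod n + 1\<close> is the representative of \<open>j + m\<close> modulo \<open>n\<close> in \<open>{1..n}\<close>.\<close>

definition frozen :: "nat \<Rightarrow> nat \<Rightarrow> nat set \<Rightarrow> bool"
  where "frozen k n J \<longleftrightarrow> (\<exists>j\<in>{1..n}. J = (\<lambda>m. (j - 1 + m) mod n + 1) ` {0..k-1})"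

definition nonfrozen_subsets :: "nat \<Rightarrow> nat \<Rightarrow> nat set set"
  where "nonfrozen_subsets k n = {J. J \<subseteq> {1..n} \<and> card J = k \<and> \<not> frozen k n J}"

text \<open>The \<open>i\<close>-th smallest element of a finite set \<open>J\<close>, counting from 1.\<close>

definition nth_elem :: "nat set \<Rightarrow> nat \<Rightarrow> nat"
  where "nth_elem J i = sorted_list_of_set J ! (i - 1)"

text \<open>
  Subtraction of naturals does not truncate below: for a \<open>k\<close>-subset \<open>J\<close> of \<open>{1..n}\<close> one has
  \<open>nth_elem J i \<ge> i\<close> and \<open>nth_elem J (i + 1) \<ge> i + 1\<close>.
\<close>

definition Pi_polyhedron ::
  "nat \<Rightarrow> nat \<Rightarrow> (nat \<Rightarrow> 'r) \<Rightarrow> (nat \<Rightarrow> 'c) \<Rightarrow> (real ^ 'c::finite ^ 'r::finite) set"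
  where "Pi_polyhedron k n \<rho> \<kappa> =
    {\<alpha> \<in> zero_row_space k n \<rho> \<kappa>. \<forall>J\<in>nonfrozen_subsets k n.
       (\<Sum>i = 1..k-1.
          row_sum \<rho> \<kappa> \<alpha> i (nth_elem J i - (i - 1)) (nth_elem J (i + 1) - i - 1)) + 1 \<ge> 0}"

definition lattice_points ::
  "nat \<Rightarrow> nat \<Rightarrow> (nat \<Rightarrow> 'r) \<Rightarrow> (nat \<Rightarrow> 'c) \<Rightarrow> (real ^ 'c::finite ^ 'r::finite) set"
  where "lattice_points k n \<rho> \<kappa> =
    {\<alpha> \<in> zero_row_space k n \<rho> \<kappa>.
       \<forall>i\<in>{1..k-1}. \<forall>j\<in>{1..n-k}. \<alpha> $ \<rho> i $ \<kappa> j \<in> \<int>}"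

text \<open>
  The polyhedron is full-dimensional in \<^const>\<open>zero_row_space\<close>, so the library's \<open>facet_of\<close>,
  which measures codimension in the affine hull of the polyhedron, agrees with codimension one in
  \<^const>\<open>zero_row_space\<close>.
\<close>

lemma subspace_zero_row_space: "subspace (zero_row_space k n \<rho> \<kappa>)"
  by (auto simp: zero_row_space_def subspace_def sum.distrib simp flip: sum_distrib_left)

lemma aff_dim_Pi_polyhedron:
  "aff_dim (Pi_polyhedron k n \<rho> \<kappa>) = aff_dim (zero_row_space k n \<rho> \<kappa>)"
proof -
  let ?H = "zero_row_space k n \<rho> \<kappa>"
  let ?f = "\<lambda>J \<alpha>. (\<Sum>i = 1..k-1.
    row_sum \<rho> \<kappa> \<alpha> i (nth_elem J i - (i - 1)) (nth_elem J (i + 1) - i - 1)) + 1"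
  define V where "V = (\<Inter>J\<in>nonfrozen_subsets k n. {\<alpha>. ?f J \<alpha> > 0})"
  have "finite (nonfrozen_subsets k n)"
    unfolding nonfrozen_subsets_def by (rule finite_subset[of _ "Pow {1..n}"]) auto
  moreover have "open {\<alpha>. ?f J \<alpha> > 0}" for J
    unfolding row_sum_def by (intro open_Collect_less continuous_intros)
  ultimately have "open V"
    unfolding V_def by auto
  then have "openin (top_of_set ?H) (?H \<inter> V)"
    by (rule openin_open_Int)
  moreover have "0 \<in> ?H \<inter> V"
    by (auto simp: V_def zero_row_space_def row_sum_def)
  ultimately have "aff_dim (?H \<inter> V) = aff_dim ?H"
    using subspace_zero_row_space subspace_imp_affine by (intro aff_dim_openin) blast+
  moreover have "?H \<inter> V \<subseteq> Pi_polyhedron k n \<rho> \<kappa>"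
    by (force simp: V_def Pi_polyhedron_def intro: less_imp_le)
  moreover have "Pi_polyhedron k n \<rho> \<kappa> \<subseteq> ?H"
    by (auto simp: Pi_polyhedron_def)
  ultimately show ?thesis
    by (metis aff_dim_subset order_antisym)
qed

lemma facet_of_Pi_polyhedron_iff:
  "F facet_of Pi_polyhedron k n \<rho> \<kappa> \<longleftrightarrow>
   F face_of Pi_polyhedron k n \<rho> \<kappa> \<and> F \<noteq> {} \<and>
   aff_dim F = aff_dim (zero_row_space k n \<rho> \<kappa>) - 1"
  by (simp add: facet_of_def aff_dim_Pi_polyhedron)

end

theory Submission
  imports Defs
begin

text \<open>
  Write \<open>J = {j\<^sub>1 < \<dots> < j\<^sub>k}\<close> as the weakly increasing sequence \<open>l\<^sub>i = j\<^sub>i - i\<close> with values in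
  \<open>{0..n-k}\<close>. The linear part \<open>\<gamma>\<^sub>J\<close> of the inequality for \<open>J\<close> then sums \<open>\<alpha>\<^sub>i\<^sub>,\<^sub>j\<close> over the rows \<open>i\<close>
  and the columns \<open>l\<^sub>i < j \<le> l\<^sub>i\<^sub>+\<^sub>1\<close>. Give the columns that no row uses to an additional row 0. Now the
  \<open>k\<close> rows \<open>0, \<dots>, k-1\<close> partition the \<open>n-k\<close> columns into \<open>strips\<close>, so \<open>J\<close> selects one cell in
  each column. The frozen sets are exactly those for which one strip contains all the columns.

  \<^bold>\<open>Facets.\<close> The count is the statement that no inequality is redundant. For nonfrozen \<open>J\<close> let
  \<open>w\<close> be the matrix with rows \<open>0, \<dots>, k-1\<close> that has entry 1 on the cells selected by \<open>J\<close> and, in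
  each row, a constant on the other cells that makes the row sum vanish. As no strip of \<open>J\<close> is full,
  this constant exists, and it is at most 0. Hence \<open>J\<close> has weight \<open>n-k\<close>, the largest possible one,
  and every other selection has smaller weight. Subtracting row 0 from all rows changes every weight
  by the sum of row 0, which is 0; a negative multiple of the result is a point of the space where
  \<open>\<gamma>\<^sub>J = -1\<close> while \<open>\<gamma>\<^sub>J\<^sub>' > -1\<close> for every other nonfrozen \<open>J'\<close> (\<open>exists_exposing_point\<close>). Scaling this
  point slightly outwards violates only the inequality for \<open>J\<close>. So the facets correspond to the
  nonfrozen sets, and there are \<open>n\<close> cyclic intervals to discard.

  \<^bold>\<open>Interior lattice point.\<close> In the interior every \<open>\<gamma>\<^sub>J\<close> exceeds \<open>-1\<close>. Each single entry \<open>\<alpha>\<^sub>i\<^sub>,\<^sub>j\<close> is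
  some \<open>\<gamma>\<^sub>J\<close> with \<open>J\<close> nonfrozen, so an interior lattice point has nonnegative entries, and as its
  rows sum to 0 it vanishes.
\<close>

section \<open>Cyclic intervals\<close>

definition cyclic_interval :: "nat \<Rightarrow> nat \<Rightarrow> nat \<Rightarrow> nat set"
  where "cyclic_interval k n j = (\<lambda>m. (j - 1 + m) mod n + 1) ` {0..k-1}"

lemma frozen_iff: "frozen k n J \<longleftrightarrow> (\<exists>j\<in>{1..n}. J = cyclic_interval k n j)"
  by (simp add: frozen_def cyclic_interval_def)

text \<open>
  A proper cyclic interval has a single place where one steps out of it, namely its last element. This
  recovers the interval's starting point, and it shows that a set with two such places is nonfrozen.
\<close>
lemma cyclic_interval_last:
  assumes "1 \<le> k" "k < n"
  shows "x \<in> cyclic_interval k n j \<and> x mod n + 1 \<notin> cyclic_interval k n j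
           \<longleftrightarrow> x = (j - 1 + (k - 1)) mod n + 1"
proof
  assume x: "x \<in> cyclic_interval k n j \<and> x mod n + 1 \<notin> cyclic_interval k n j"
  then obtain m where m: "m \<le> k - 1" "x = (j - 1 + m) mod n + 1"
    by (auto simp: cyclic_interval_def)
  have "x mod n + 1 = (j - 1 + Suc m) mod n + 1"
    using m by (simp add: mod_Suc_eq)
  with x have "\<not> Suc m \<le> k - 1"
    unfolding cyclic_interval_def by fastforce
  with m have "m = k - 1" by simp
  with m show "x = (j - 1 + (k - 1)) mod n + 1" by simp
next
  assume x: "x = (j - 1 + (k - 1)) mod n + 1"
  have "x mod n + 1 \<noteq> (j - 1 + m) mod n + 1" if "m \<le> k - 1" for m
  proof
    assume "x mod n + 1 = (j - 1 + m) mod n + 1"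
    with x assms have "(j - 1 + k) mod n = (j - 1 + m) mod n"
      by (simp add: mod_Suc_eq)
    with that assms have "n dvd k - m"
      using mod_eq_dvd_iff_nat[of "j - 1 + m" "j - 1 + k" n] by simp
    with that assms show False
      by (auto dest!: dvd_imp_le)
  qed
  then have "x mod n + 1 \<notin> cyclic_interval k n j"
    unfolding cyclic_interval_def image_iff by (meson atLeastAtMost_iff)
  moreover have "x \<in> cyclic_interval k n j"
    using x by (auto simp: cyclic_interval_def)
  ultimately show "x \<in> cyclic_interval k n j \<and> x mod n + 1 \<notin> cyclic_interval k n j"
    by blast
qed

lemma inj_on_cyclic_interval:
  assumes "1 \<le> k" "k < n"
  shows "inj_on (cyclic_interval k n) {1..n}"
proof (rule linorder_inj_onI)
  fix a b assume ab: "a < b" "a \<in> {1..n}" "b \<in> {1..n}"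
  show "cyclic_interval k n a \<noteq> cyclic_interval k n b"
  proof
    assume "cyclic_interval k n a = cyclic_interval k n b"
    then have "(a - 1 + (k - 1)) mod n = (b - 1 + (k - 1)) mod n"
      using cyclic_interval_last[OF assms, of _ a] cyclic_interval_last[OF assms, of _ b]
      by (metis add_right_cancel)
    with ab have "n dvd b - a"
      using mod_eq_dvd_iff_nat[of "a - 1 + (k - 1)" "b - 1 + (k - 1)" n] by simp
    with ab show False by (auto dest!: dvd_imp_le)
  qed
qed auto

lemma card_cyclic_interval:
  assumes "1 \<le> k" "k < n"
  shows "card (cyclic_interval k n j) = k"
proof -
  have "inj_on (\<lambda>m. (j - 1 + m) mod n + 1) {0..k-1}"
  proof (rule linorder_inj_onI)
    fix x y assume xy: "x < y" "x \<in> {0..k-1}" "y \<in> {0..k-1}"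
    show "(j - 1 + x) mod n + 1 \<noteq> (j - 1 + y) mod n + 1"
    proof
      assume "(j - 1 + x) mod n + 1 = (j - 1 + y) mod n + 1"
      then have "n dvd y - x"
        using xy mod_eq_dvd_iff_nat[of "j - 1 + x" "j - 1 + y" n] by simp
      with xy assms show False by (auto dest!: dvd_imp_le)
    qed
  qed auto
  then show ?thesis
    unfolding cyclic_interval_def using assms by (simp add: card_image)
qed

lemma frozenI:
  assumes "1 \<le> k" "k < n" "card J = k" "j \<in> {1..n}" "J \<subseteq> cyclic_interval k n j"
  shows "frozen k n J"
proof -
  have "J = cyclic_interval k n j"
    using assms card_cyclic_interval[of k n j]
    by (intro card_seteq) (auto simp: cyclic_interval_def)
  with assms show ?thesis by (auto simp: frozen_iff)
qed

lemma finite_nonfrozen_subsets: "finite (nonfrozen_subsets k n)"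
  unfolding nonfrozen_subsets_def by (rule finite_subset[of _ "Pow {1..n}"]) auto

text \<open>The \<open>n\<close> cyclic intervals are distinct because their last elements are.\<close>
lemma card_nonfrozen_subsets:
  assumes "1 \<le> k" "k < n"
  shows "card (nonfrozen_subsets k n) = (n choose k) - n"
proof -
  let ?A = "{J. J \<subseteq> {1..n} \<and> card J = k}"
  have sub: "cyclic_interval k n j \<subseteq> {1..n}" for j
    using assms by (auto simp: cyclic_interval_def Suc_le_eq)
  have "nonfrozen_subsets k n = ?A - cyclic_interval k n ` {1..n}"
    by (auto simp: nonfrozen_subsets_def frozen_iff)
  moreover have "cyclic_interval k n ` {1..n} \<subseteq> ?A"
    using sub card_cyclic_interval[OF assms] by auto
  ultimately have "card (nonfrozen_subsets k n) = card ?A - card (cyclic_interval k n ` {1..n})"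
    by (simp add: card_Diff_subset)
  also have "card ?A = n choose k"
    using n_subsets[of "{1..n}" k] by simp
  also have "card (cyclic_interval k n ` {1..n}) = n"
    using inj_on_cyclic_interval[OF assms] by (simp add: card_image)
  finally show ?thesis .
qed

section \<open>Subsets as monotone sequences\<close>

definition shift :: "nat set \<Rightarrow> nat \<Rightarrow> nat"
  where "shift J i = nth_elem J i - i"

lemma nth_elem_image:
  assumes "\<And>a b. 1 \<le> a \<Longrightarrow> a < b \<Longrightarrow> b \<le> k \<Longrightarrow> f a < f b" and i: "i \<in> {1..k}"
  shows "nth_elem (f ` {1..k}) i = f i"
proof -
  have s: "sorted_wrt (<) (map f [1..<Suc k])"
    unfolding sorted_wrt_map
    by (rule sorted_wrt_mono_rel[OF _ sorted_wrt_upt]) (use assms in auto)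
  then have "sorted_list_of_set (set (map f [1..<Suc k])) = map f [1..<Suc k]"
    by (intro sorted_list_of_set.idem_if_sorted_distinct) (auto simp: strict_sorted_iff)
  moreover have "set (map f [1..<Suc k]) = f ` {1..k}"
    by (auto simp del: upt_Suc)
  ultimately have "nth_elem (f ` {1..k}) i = map f [1..<Suc k] ! (i - 1)"
    by (simp add: nth_elem_def)
  also have "\<dots> = f i" using i by (subst nth_map) (auto simp del: upt_Suc)
  finally show ?thesis .
qed

context
  fixes k n :: nat and J :: "nat set"
  assumes J: "J \<subseteq> {1..n}" "card J = k"
begin

lemma finite_J: "finite J"
  using J(1) finite_subset by blast

lemma nth_elem_mem: "i \<in> {1..k} \<Longrightarrow> nth_elem J i \<in> J"
  using J finite_J nth_mem[of "i - 1" "sorted_list_of_set J"]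
  by (auto simp: nth_elem_def)

lemma nth_elem_less: "1 \<le> a \<Longrightarrow> a < b \<Longrightarrow> b \<le> k \<Longrightarrow> nth_elem J a < nth_elem J b"
  using J(2) sorted_wrt_nth_less[OF strict_sorted_list_of_set[of J], of "a - 1" "b - 1"]
  by (auto simp: nth_elem_def)

lemma nth_elem_ge: "i \<in> {1..k} \<Longrightarrow> i \<le> nth_elem J i"
proof (induction i)
  case (Suc i)
  show ?case
  proof (cases "i = 0")
    case True
    then show ?thesis using nth_elem_mem[of "Suc i"] Suc J by auto
  next
    case False
    then show ?thesis using Suc nth_elem_less[of i "Suc i"] by auto
  qed
qed auto

lemma shift_Suc: "i \<in> {1..<k} \<Longrightarrow> shift J i \<le> shift J (Suc i)"
  using nth_elem_less[of i "Suc i"] nth_elem_ge[of i] by (auto simp: shift_def)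

lemma shift_mono: "1 \<le> a \<Longrightarrow> a \<le> b \<Longrightarrow> b \<le> k \<Longrightarrow> shift J a \<le> shift J b"
proof (induction b rule: nat_induct)
  case (Suc b)
  then show ?case
    by (cases "a = Suc b") (use shift_Suc[of b] in auto)
qed auto

lemma shift_le: "i \<in> {1..k} \<Longrightarrow> shift J i \<le> n - k"
  using shift_mono[of i k] nth_elem_mem[of k] J(1) by (force simp: shift_def)

lemma image_shift: "J = (\<lambda>i. shift J i + i) ` {1..k}"
proof -
  have "J = (\<lambda>i. sorted_list_of_set J ! i) ` {..<k}"
    using J(2) finite_J set_conv_nth[of "sorted_list_of_set J"] by auto
  also have "{..<k} = (\<lambda>i. i - 1) ` {1..k}"
    by (force simp: image_iff)
  also have "(\<lambda>i. sorted_list_of_set J ! i) ` \<dots> = (\<lambda>i. shift J i + i) ` {1..k}"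
    unfolding image_image using nth_elem_ge
    by (intro image_cong) (auto simp: shift_def nth_elem_def)
  finally show ?thesis .
qed

end

text \<open>
  For \<open>i \<ge> 1\<close> these are the columns in which \<open>J\<close> selects row \<open>i\<close>. Row 0 does not occur in the
  matrices; it collects the remaining columns, so that rows \<open>0, \<dots>, k-1\<close> partition all columns.
\<close>
definition strip :: "nat \<Rightarrow> nat \<Rightarrow> nat set \<Rightarrow> nat \<Rightarrow> nat set"
  where "strip k n J i =
    (if i = 0 then {1..n-k} - {shift J 1<..shift J k} else {shift J i<..shift J (Suc i)})"

lemma sum_telescope_intervals:
  fixes f :: "nat \<Rightarrow> 'a::comm_monoid_add"
  assumes "1 \<le> k" "\<And>i. i \<in> {1..<k} \<Longrightarrow> l i \<le> l (Suc i)"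
  shows "(\<Sum>i=1..k-1. \<Sum>j\<in>{l i<..l (Suc i)}. f j) = (\<Sum>j\<in>{l 1<..l k}. f j) \<and> l 1 \<le> (l k :: nat)"
  using assms
proof (induction k rule: nat_induct_at_least)
  case (Suc k)
  then have IH: "(\<Sum>i=1..k-1. \<Sum>j\<in>{l i<..l (Suc i)}. f j) = (\<Sum>j\<in>{l 1<..l k}. f j)"
    "l 1 \<le> l k" and le: "l k \<le> l (Suc k)" by auto
  have "{1..Suc k - 1} = insert k {1..k-1}" using Suc.hyps by auto
  then have "(\<Sum>i=1..Suc k-1. \<Sum>j\<in>{l i<..l (Suc i)}. f j)
    = (\<Sum>j\<in>{l k<..l (Suc k)}. f j) + (\<Sum>j\<in>{l 1<..l k}. f j)"
    using Suc.hyps IH by (subst \<open>{1..Suc k - 1} = _\<close>, subst sum.insert) auto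
  also have "\<dots> = (\<Sum>j\<in>{l 1<..l k} \<union> {l k<..l (Suc k)}. f j)"
    by (subst sum.union_disjoint) (auto simp: add.commute)
  also have "{l 1<..l k} \<union> {l k<..l (Suc k)} = {l 1<..l (Suc k)}"
    using IH(2) le by auto
  finally show ?case using IH(2) le by auto
qed auto

lemma strip_subset:
  assumes "J \<subseteq> {1..n}" "card J = k" "i < k"
  shows "strip k n J i \<subseteq> {1..n-k}"
  using shift_le[OF assms(1,2), of "Suc i"] assms(3) by (auto simp: strip_def)

lemma finite_strip: "finite (strip k n J i)"
  by (simp add: strip_def)

text \<open>
  The only form in which the partition property is needed: a sum over all selected cells of a quantity
  that depends on the column alone is the sum over all columns. Taking the quantity to be 1 counts
  the cells.
\<close>
lemma sum_strips:
  fixes f :: "nat \<Rightarrow> 'a::comm_monoid_add"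
  assumes J: "J \<subseteq> {1..n}" "card J = k" and k: "1 \<le> k"
  shows "(\<Sum>i<k. \<Sum>j\<in>strip k n J i. f j) = (\<Sum>j=1..n-k. f j)"
proof -
  have "{..<k} = insert 0 {1..k-1}" using k by auto
  then have "(\<Sum>i<k. \<Sum>j\<in>strip k n J i. f j)
    = (\<Sum>j\<in>strip k n J 0. f j) + (\<Sum>i=1..k-1. \<Sum>j\<in>{shift J i<..shift J (Suc i)}. f j)"
    by (simp add: strip_def)
  also have "(\<Sum>i=1..k-1. \<Sum>j\<in>{shift J i<..shift J (Suc i)}. f j) = (\<Sum>j\<in>{shift J 1<..shift J k}. f j)"
    using sum_telescope_intervals[OF k, of "shift J" f] shift_Suc[OF J] by auto
  also have "(\<Sum>j\<in>strip k n J 0. f j) + \<dots> = (\<Sum>j=1..n-k. f j)"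
    using shift_le[OF J, of k] k
    by (subst sum.subset_diff[of "{shift J 1<..shift J k}" "{1..n-k}"]) (auto simp: strip_def)
  finally show ?thesis .
qed

text \<open>
  If row 0 takes all columns, the sequence \<open>shift J\<close> is constant and \<open>J\<close> is an interval. If row
  \<open>i \<ge> 1\<close> does, the sequence jumps from 0 to \<open>n-k\<close> after position \<open>i\<close>, and \<open>J\<close> is the cyclic interval
  that wraps around from \<open>n-k+i+1\<close> to \<open>i\<close>.
\<close>
lemma card_strip_less:
  assumes J: "J \<subseteq> {1..n}" "card J = k" and kn: "1 \<le> k" "k < n"
    and nf: "\<not> frozen k n J" and i: "i < k"
  shows "card (strip k n J i) < n - k"
proof (rule ccontr)
  assume "\<not> ?thesis"
  then have full: "strip k n J i = {1..n-k}"
    using strip_subset[OF J i] by (intro card_seteq) auto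
  note le = shift_le[OF J] and mono = shift_mono[OF J]
  show False
  proof (cases "i = 0")
    case True
    have "shift J 1 = shift J k"
    proof (rule ccontr)
      assume "shift J 1 \<noteq> shift J k"
      then have "shift J k \<in> {1..n-k}" "shift J k \<in> {shift J 1<..shift J k}"
        using mono[of 1 k] le[of k] kn by auto
      with full True show False by (auto simp: strip_def)
    qed
    then have c: "shift J x = shift J 1" if "x \<in> {1..k}" for x
      using that mono[of 1 x] mono[of x k] by auto
    have "J \<subseteq> cyclic_interval k n (shift J 1 + 1)"
    proof
      fix y assume "y \<in> J"
      then obtain x where x: "x \<in> {1..k}" "y = shift J x + x"
        using image_shift[OF J] by blast
      then have "y = (shift J 1 + 1 - 1 + (x - 1)) mod n + 1" "x - 1 \<in> {0..k-1}"
        using c[of x] le[of 1] kn by auto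
      then show "y \<in> cyclic_interval k n (shift J 1 + 1)"
        unfolding cyclic_interval_def by blast
    qed
    moreover have "shift J 1 + 1 \<in> {1..n}" using le[of 1] kn by auto
    ultimately show False using frozenI[OF kn J(2)] nf by blast
  next
    case False
    have "1 \<in> {1..n-k}" "n - k \<in> {1..n-k}" using kn by auto
    with full False have "shift J i < 1 \<and> n - k \<le> shift J (Suc i)"
      unfolding strip_def by (metis greaterThanAtMost_iff)
    then have c: "shift J x = (if x \<le> i then 0 else n - k)" if "x \<in> {1..k}" for x
      using that mono[of x i] mono[of "Suc i" x] le[of x] i by auto
    have "J \<subseteq> cyclic_interval k n (n - k + i + 1)"
    proof
      fix y assume "y \<in> J"
      then obtain x where x: "x \<in> {1..k}" "y = shift J x + x"
        using image_shift[OF J] by blast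
      \<comment> \<open>the wrap-around interval lists the \<open>k - i\<close> elements beyond position \<open>i\<close> first\<close>
      define t where "t = (if x \<le> i then x - 1 + (k - i) else x - i - 1)"
      have "y = (n - k + i + 1 - 1 + t) mod n + 1"
      proof (cases "x \<le> i")
        case True
        then have "n - k + i + 1 - 1 + t = (x - 1) + n"
          using kn i x by (auto simp: t_def)
        then have "(n - k + i + 1 - 1 + t) mod n = (x - 1) mod n" by simp
        with True x c[of x] i kn show ?thesis by simp
      next
        case False
        then have "n - k + i + 1 - 1 + t = n - k + x - 1"
          using kn i x by (auto simp: t_def)
        with False x c[of x] i kn show ?thesis by simp
      qed
      moreover have "t \<in> {0..k-1}" using x i by (auto simp: t_def)
      ultimately show "y \<in> cyclic_interval k n (n - k + i + 1)"
        unfolding cyclic_interval_def by blast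
    qed
    moreover have "n - k + i + 1 \<in> {1..n}" using i kn by auto
    ultimately show False using frozenI[OF kn J(2)] nf by blast
  qed
qed

text \<open>
  The lengths of the strips determine \<open>shift J\<close> up to an additive constant, and the position of any
  nonempty strip fixes the constant. A nonempty strip exists unless row 0 takes all columns, which is
  where \<open>J\<close> has to be nonfrozen.
\<close>
lemma eq_if_strips_eq:
  assumes J: "J \<subseteq> {1..n}" "card J = k" and kn: "1 \<le> k" "k < n"
    and nf: "\<not> frozen k n J"
    and J': "J' \<subseteq> {1..n}" "card J' = k"
    and eq: "\<And>i. i < k \<Longrightarrow> strip k n J i = strip k n J' i"
  shows "J = J'"
proof -
  have diff: "shift J x + shift J' 1 = shift J' x + shift J 1" if "1 \<le> x" "x \<le> k" for x
    using that
  proof (induction x rule: nat_induct_at_least)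
    case (Suc x)
    have "card (strip k n J x) = card (strip k n J' x)" using eq Suc by simp
    then have "shift J (Suc x) - shift J x = shift J' (Suc x) - shift J' x"
      using Suc by (simp add: strip_def)
    then show ?case
      using Suc shift_Suc[OF J, of x] shift_Suc[OF J', of x] by auto
  qed auto
  have "strip k n J 0 \<noteq> {1..n-k}"
    using card_strip_less[OF J kn nf, of 0] kn by auto
  then have "shift J 1 < shift J k" by (auto simp: strip_def)
  then have "\<exists>i\<in>{1..<k}. shift J i < shift J (Suc i)"
  proof (rule contrapos_pp)
    assume *: "\<not> (\<exists>i\<in>{1..<k}. shift J i < shift J (Suc i))"
    have "shift J x \<le> shift J 1" if "1 \<le> x" "x \<le> k" for x
      using that
      by (induction x rule: nat_induct_at_least) (use * in \<open>force simp: not_less\<close>)+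
    with kn show "\<not> shift J 1 < shift J k" by (auto simp: not_less)
  qed
  then obtain i where i: "i \<in> {1..<k}" "shift J i < shift J (Suc i)" by blast
  with eq[of i] have "shift J i = shift J' i"
    using shift_Suc[OF J' i(1)] by (auto simp: strip_def Ioc_inj)
  with diff[of i] i have "shift J 1 = shift J' 1" by auto
  with diff have "shift J x = shift J' x" if "x \<in> {1..k}" for x using that by auto
  then show ?thesis
    using image_shift[OF J] image_shift[OF J'] by (metis (no_types, lifting) image_cong)
qed

section \<open>The defining functionals and their exposing points\<close>

definition gamma ::
  "nat \<Rightarrow> (nat \<Rightarrow> 'r) \<Rightarrow> (nat \<Rightarrow> 'c) \<Rightarrow> nat set \<Rightarrow> real ^ 'c::finite ^ 'r::finite \<Rightarrow> real"
  where "gamma k \<rho> \<kappa> J \<alpha> =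
    (\<Sum>i = 1..k-1. row_sum \<rho> \<kappa> \<alpha> i (nth_elem J i - (i - 1)) (nth_elem J (i + 1) - i - 1))"

lemma Pi_polyhedron_eq:
  "Pi_polyhedron k n \<rho> \<kappa> =
    {\<alpha> \<in> zero_row_space k n \<rho> \<kappa>. \<forall>J\<in>nonfrozen_subsets k n. - 1 \<le> gamma k \<rho> \<kappa> J \<alpha>}"
  by (force simp: Pi_polyhedron_def gamma_def)

lemma linear_gamma: "linear (gamma k \<rho> \<kappa> J)"
  by (rule linearI)
    (simp_all add: gamma_def row_sum_def sum.distrib flip: sum_distrib_left)

lemma gamma_eq_sum_strips:
  assumes J: "J \<subseteq> {1..n}" "card J = k"
  shows "gamma k \<rho> \<kappa> J \<alpha> = (\<Sum>i=1..k-1. \<Sum>j\<in>strip k n J i. \<alpha> $ \<rho> i $ \<kappa> j)"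
  unfolding gamma_def row_sum_def
proof (intro sum.cong refl)
  fix i assume i: "i \<in> {1..k-1}"
  then show "{nth_elem J i - (i - 1)..nth_elem J (i + 1) - i - 1} = strip k n J i"
    using nth_elem_ge[OF J, of i] nth_elem_ge[OF J, of "Suc i"]
    by (auto simp: strip_def shift_def Suc_diff_le Suc_le_eq)
qed

lemma exists_matrix:
  fixes \<rho> :: "nat \<Rightarrow> 'r::finite" and \<kappa> :: "nat \<Rightarrow> 'c::finite" and g :: "nat \<Rightarrow> nat \<Rightarrow> real"
  assumes "inj_on \<rho> A" "inj_on \<kappa> B"
  shows "\<exists>\<alpha> :: real ^ 'c ^ 'r. \<forall>i\<in>A. \<forall>j\<in>B. \<alpha> $ \<rho> i $ \<kappa> j = g i j"
  using assms
  by (intro exI[of _ "\<chi> r c. g (inv_into A \<rho> r) (inv_into B \<kappa> c)"]) simp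

text \<open>
  The functional \<open>\<gamma>\<^sub>J\<close> is a vertex of the convex hull of all of them: the matrix \<open>w\<close> rewards exactly
  the cells that \<open>J\<close> selects, and any other nonfrozen set selects some cell outside, at a loss.
\<close>
lemma exists_exposing_point:
  fixes \<rho> :: "nat \<Rightarrow> 'r::finite" and \<kappa> :: "nat \<Rightarrow> 'c::finite"
  assumes k: "1 \<le> k" "k < n" and inj: "inj_on \<rho> {1..k-1}" "inj_on \<kappa> {1..n-k}"
    and J: "J \<in> nonfrozen_subsets k n"
  shows "\<exists>\<alpha>\<in>zero_row_space k n \<rho> \<kappa>. gamma k \<rho> \<kappa> J \<alpha> = -1 \<and>
           (\<forall>J'\<in>nonfrozen_subsets k n. J' \<noteq> J \<longrightarrow> -1 < gamma k \<rho> \<kappa> J' \<alpha>)"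
proof -
  from J have J1: "J \<subseteq> {1..n}" "card J = k" and nf: "\<not> frozen k n J"
    by (auto simp: nonfrozen_subsets_def)
  define m where "m = real (n - k)"
  have m: "m > 0" using k by (simp add: m_def)
  define l where "l i = real (card (strip k n J i))" for i
  have l: "l i < m" if "i < k" for i
    using card_strip_less[OF J1 k nf that] by (simp add: l_def m_def)
  have l0: "l i \<ge> 0" for i by (simp add: l_def)
  define w where "w i j = (if j \<in> strip k n J i then 1 else - l i / (m - l i))" for i j
  have w_neg: "w i j \<le> 0" if "i < k" "j \<notin> strip k n J i" for i j
    using l[OF that(1)] l0[of i] that(2) by (simp add: w_def divide_nonneg_pos)
  have w_le: "w i j \<le> 1" if "i < k" for i j
    using w_neg[OF that, of j] by (cases "j \<in> strip k n J i") (auto simp: w_def)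
  have w_row: "(\<Sum>j=1..n-k. w i j) = 0" if "i < k" for i
  proof -
    have sub: "strip k n J i \<subseteq> {1..n-k}" by (rule strip_subset[OF J1 that])
    have "(\<Sum>j=1..n-k. w i j)
        = (\<Sum>j\<in>{1..n-k} - strip k n J i. w i j) + (\<Sum>j\<in>strip k n J i. w i j)"
      using sub by (simp add: sum.subset_diff)
    also have "\<dots> = real (card ({1..n-k} - strip k n J i)) * (- l i / (m - l i)) + l i"
      by (simp add: w_def l_def)
    also have "real (card ({1..n-k} - strip k n J i)) = m - l i"
      using sub card_mono[OF _ sub] by (simp add: card_Diff_subset finite_strip l_def m_def)
    also have "(m - l i) * (- l i / (m - l i)) + l i = 0" using l[OF that] by simp
    finally show ?thesis .
  qed
  \<comment> \<open>subtracting row 0 eliminates it; the factor \<open>- 1 / m\<close> turns the maximal weight \<open>m\<close> into \<open>- 1\<close>\<close>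
  obtain \<alpha> :: "real ^ 'c ^ 'r"
    where \<alpha>: "\<And>i j. i \<in> {1..k-1} \<Longrightarrow> j \<in> {1..n-k} \<Longrightarrow> \<alpha> $ \<rho> i $ \<kappa> j = (w 0 j - w i j) / m"
    using exists_matrix[OF inj, of "\<lambda>i j. (w 0 j - w i j) / m"] by blast
  have "\<alpha> \<in> zero_row_space k n \<rho> \<kappa>"
    using w_row k \<alpha> by (auto simp: zero_row_space_def sum_subtractf simp flip: sum_divide_distrib)
  moreover have gamma: "gamma k \<rho> \<kappa> J' \<alpha> = - (\<Sum>i<k. \<Sum>j\<in>strip k n J' i. w i j) / m"
    if J': "J' \<subseteq> {1..n}" "card J' = k" for J'
  proof -
    have "gamma k \<rho> \<kappa> J' \<alpha> = (\<Sum>i=1..k-1. \<Sum>j\<in>strip k n J' i. (w 0 j - w i j) / m)"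
      unfolding gamma_eq_sum_strips[OF J']
    proof (intro sum.cong refl)
      fix i j assume i: "i \<in> {1..k-1}" and j: "j \<in> strip k n J' i"
      then have "i < k" by auto
      from strip_subset[OF J' this] j i show "\<alpha> $ \<rho> i $ \<kappa> j = (w 0 j - w i j) / m"
        by (intro \<alpha>) auto
    qed
    also have "\<dots> = (\<Sum>i<k. \<Sum>j\<in>strip k n J' i. (w 0 j - w i j) / m)"
      using k by (intro sum.mono_neutral_left) (auto simp: Suc_le_eq not_less_eq)
    also have "\<dots> = ((\<Sum>i<k. \<Sum>j\<in>strip k n J' i. w 0 j) - (\<Sum>i<k. \<Sum>j\<in>strip k n J' i. w i j)) / m"
      by (simp add: sum_subtractf flip: sum_divide_distrib)
    also have "(\<Sum>i<k. \<Sum>j\<in>strip k n J' i. w 0 j) = 0"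
      using sum_strips[OF J' k(1), of "w 0"] w_row k by simp
    finally show ?thesis by simp
  qed
  have count: "(\<Sum>i<k. card (strip k n J' i)) = n - k"
    if J': "J' \<subseteq> {1..n}" "card J' = k" for J'
    using sum_strips[OF J' k(1), of "\<lambda>_. 1 :: nat"] by simp
  have "gamma k \<rho> \<kappa> J \<alpha> = - 1"
  proof -
    have "(\<Sum>i<k. \<Sum>j\<in>strip k n J i. w i j) = real (\<Sum>i<k. card (strip k n J i))"
      by (simp add: w_def)
    then show ?thesis using gamma[OF J1] count[OF J1] m by (simp add: m_def)
  qed
  moreover have "- 1 < gamma k \<rho> \<kappa> J' \<alpha>" if "J' \<in> nonfrozen_subsets k n" "J' \<noteq> J" for J'
  proof -
    from that have J': "J' \<subseteq> {1..n}" "card J' = k"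
      by (auto simp: nonfrozen_subsets_def)
    \<comment> \<open>strips of \<open>J'\<close> inside those of \<open>J\<close> would equal them, since both families have \<open>n - k\<close> cells\<close>
    have "\<exists>i<k. \<not> strip k n J' i \<subseteq> strip k n J i"
    proof (rule ccontr)
      assume "\<not> ?thesis"
      then have sub: "strip k n J' i \<subseteq> strip k n J i" if "i < k" for i using that by blast
      have "strip k n J i = strip k n J' i" if i: "i < k" for i
      proof -
        have "card (strip k n J' i) = card (strip k n J i)"
        proof (rule sum_mono_inv[where I = "{..<k}" and i = i])
          show "(\<Sum>i<k. card (strip k n J' i)) = (\<Sum>i<k. card (strip k n J i))"
            by (simp add: count[OF J'] count[OF J1])
          show "card (strip k n J' i) \<le> card (strip k n J i)" if "i \<in> {..<k}" for i
            using that by (intro card_mono finite_strip sub) auto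
        qed (use i in auto)
        then show ?thesis
          using card_subset_eq[OF finite_strip sub[OF i]] by simp
      qed
      then show False using eq_if_strips_eq[OF J1 k nf J'] that(2) by blast
    qed
    then obtain i j where ij: "i < k" "j \<in> strip k n J' i" "j \<notin> strip k n J i" by blast
    have "(\<Sum>i<k. \<Sum>j\<in>strip k n J' i. w i j) < (\<Sum>i<k. \<Sum>j\<in>strip k n J' i. 1)"
    proof (rule sum_strict_mono_ex1)
      have "(\<Sum>j\<in>strip k n J' i. w i j) < (\<Sum>j\<in>strip k n J' i. 1)"
      proof (rule sum_strict_mono_ex1[OF finite_strip])
        have "w i j < 1" using w_neg[OF ij(1,3)] by linarith
        with ij(2) show "\<exists>j\<in>strip k n J' i. w i j < 1" by blast
      qed (use w_le[OF ij(1)] in blast)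
      with ij(1) show "\<exists>i\<in>{..<k}. (\<Sum>j\<in>strip k n J' i. w i j) < (\<Sum>j\<in>strip k n J' i. 1)"
        by blast
      show "\<forall>i\<in>{..<k}. (\<Sum>j\<in>strip k n J' i. w i j) \<le> (\<Sum>j\<in>strip k n J' i. 1)"
        using w_le by (intro ballI sum_mono) simp
    qed simp
    also have "\<dots> = real (\<Sum>i<k. card (strip k n J' i))" by simp
    also have "\<dots> = m" unfolding count[OF J'] m_def by (rule refl)
    finally show ?thesis using gamma[OF J'] m by simp
  qed
  ultimately show ?thesis by blast
qed

text \<open>
  Scale an exposing point by a factor slightly above 1. There are finitely many other inequalities, all
  strict at the exposing point, so they survive.
\<close>
lemma exists_violating_point:
  fixes \<rho> :: "nat \<Rightarrow> 'r::finite" and \<kappa> :: "nat \<Rightarrow> 'c::finite"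
  assumes k: "1 \<le> k" "k < n" and inj: "inj_on \<rho> {1..k-1}" "inj_on \<kappa> {1..n-k}"
    and J: "J \<in> nonfrozen_subsets k n"
  shows "\<exists>\<alpha>\<in>zero_row_space k n \<rho> \<kappa>. gamma k \<rho> \<kappa> J \<alpha> < -1 \<and>
           (\<forall>J'\<in>nonfrozen_subsets k n. J' \<noteq> J \<longrightarrow> -1 \<le> gamma k \<rho> \<kappa> J' \<alpha>)"
proof -
  obtain \<alpha> where \<alpha>: "\<alpha> \<in> zero_row_space k n \<rho> \<kappa>" "gamma k \<rho> \<kappa> J \<alpha> = -1"
    "\<And>J'. J' \<in> nonfrozen_subsets k n \<Longrightarrow> J' \<noteq> J \<Longrightarrow> -1 < gamma k \<rho> \<kappa> J' \<alpha>"
    using exists_exposing_point[OF assms] by blast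
  have "\<forall>\<^sub>F t in at_right (1::real). - 1 < t * gamma k \<rho> \<kappa> J' \<alpha>"
    if "J' \<in> nonfrozen_subsets k n - {J}" for J'
  proof (rule order_tendstoD)
    show "((\<lambda>t. t * gamma k \<rho> \<kappa> J' \<alpha>) \<longlongrightarrow> 1 * gamma k \<rho> \<kappa> J' \<alpha>) (at_right 1)"
      by (intro tendsto_intros)
  qed (use \<alpha>(3) that in auto)
  then have "\<forall>\<^sub>F t in at_right (1::real).
      \<forall>J'\<in>nonfrozen_subsets k n - {J}. - 1 < t * gamma k \<rho> \<kappa> J' \<alpha>"
    by (simp add: eventually_ball_finite finite_nonfrozen_subsets)
  moreover have "\<forall>\<^sub>F t in at_right (1::real). 1 < t"
    by (rule eventually_at_right_less)
  ultimately have "\<forall>\<^sub>F t in at_right (1::real).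
      1 < t \<and> (\<forall>J'\<in>nonfrozen_subsets k n - {J}. - 1 < t * gamma k \<rho> \<kappa> J' \<alpha>)"
    by eventually_elim blast
  then obtain t :: real where t: "1 < t"
    "\<forall>J'\<in>nonfrozen_subsets k n - {J}. - 1 < t * gamma k \<rho> \<kappa> J' \<alpha>"
    using eventually_happens'[OF trivial_limit_at_right_real] by blast
  have "t *\<^sub>R \<alpha> \<in> zero_row_space k n \<rho> \<kappa>"
    using subspace_zero_row_space \<alpha>(1) by (rule subspace_scale)
  moreover have "gamma k \<rho> \<kappa> J' (t *\<^sub>R \<alpha>) = t * gamma k \<rho> \<kappa> J' \<alpha>" for J'
    using linear_scale[OF linear_gamma] by simp
  ultimately show ?thesis
    using t \<alpha>(2) by (intro bexI[of _ "t *\<^sub>R \<alpha>"]) (auto intro: less_imp_le)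
qed

section \<open>Facets\<close>

text \<open>
  A violating point for \<open>J\<close> shows that the inequality for \<open>J\<close> is not implied by the others, so the
  description of the polyhedron is irredundant and each inequality cuts out a facet. The exposing
  point for \<open>J\<close> lies on the facet of \<open>J\<close> and on no other, so the facets are distinct.
\<close>
lemma card_facets:
  fixes \<rho> :: "nat \<Rightarrow> 'r::finite" and \<kappa> :: "nat \<Rightarrow> 'c::finite"
  assumes k: "1 \<le> k" "k < n" and inj: "inj_on \<rho> {1..k-1}" "inj_on \<kappa> {1..n-k}"
  shows "card {F. F facet_of Pi_polyhedron k n \<rho> \<kappa>} = card (nonfrozen_subsets k n)"
proof -
  let ?N = "nonfrozen_subsets k n" and ?H = "zero_row_space k n \<rho> \<kappa>"
    and ?P = "Pi_polyhedron k n \<rho> \<kappa>" and ?g = "gamma k \<rho> \<kappa>"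
  \<comment> \<open>the normal vector of the inequality, obtained by representing \<open>- \<gamma>\<^sub>J\<close> as an inner product\<close>
  define A where "A J = - adjoint (?g J) 1" for J
  have A: "A J \<bullet> \<alpha> = - ?g J \<alpha>" for J \<alpha>
    using adjoint_works[OF linear_gamma, of \<alpha> k \<rho> \<kappa> J 1] by (simp add: A_def inner_commute)
  define h where "h J = {\<alpha>. A J \<bullet> \<alpha> \<le> 1}" for J
  have viol: "\<exists>\<alpha>\<in>?H. \<alpha> \<notin> h J \<and> (\<forall>J'\<in>?N. J' \<noteq> J \<longrightarrow> \<alpha> \<in> h J')" if J: "J \<in> ?N" for J
  proof -
    obtain \<alpha> where "\<alpha> \<in> ?H" "?g J \<alpha> < -1" "\<And>K. K \<in> ?N \<Longrightarrow> K \<noteq> J \<Longrightarrow> -1 \<le> ?g K \<alpha>"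
      using exists_violating_point[OF assms J] by blast
    moreover have "\<alpha> \<in> h K \<longleftrightarrow> - 1 \<le> ?g K \<alpha>" for K
      unfolding h_def mem_Collect_eq A by linarith
    ultimately show ?thesis by (metis not_less)
  qed
  have inj_h: "inj_on h ?N"
    using viol by (intro inj_onI) metis
  define J_of where "J_of = inv_into ?N h"
  have J_of: "J_of (h J) = J" if "J \<in> ?N" for J
    using inj_h that by (simp add: J_of_def)
  have hull: "affine hull ?P = ?H"
  proof -
    have "?P \<subseteq> ?H" by (auto simp: Pi_polyhedron_def)
    then have "affine hull ?P = affine hull ?H"
      using aff_dim_eq_full_gen aff_dim_Pi_polyhedron by blast
    then show ?thesis
      using subspace_zero_row_space subspace_imp_affine affine_hull_eq by metis
  qed
  have P: "?P = ?H \<inter> \<Inter>(h ` ?N)"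
    by (force simp: Pi_polyhedron_eq h_def A)
  have facets: "F facet_of ?P \<longleftrightarrow> (\<exists>S. S \<in> h ` ?N \<and> F = ?P \<inter> {\<alpha>. A (J_of S) \<bullet> \<alpha> = 1})" for F
  proof (rule facet_of_polyhedron_explicit)
    show "finite (h ` ?N)" by (simp add: finite_nonfrozen_subsets)
    show "?P = affine hull ?P \<inter> \<Inter>(h ` ?N)" using P hull by simp
    show "A (J_of S) \<noteq> 0 \<and> S = {\<alpha>. A (J_of S) \<bullet> \<alpha> \<le> 1}" if S: "S \<in> h ` ?N" for S
    proof -
      from S obtain J where J: "J \<in> ?N" "S = h J" by blast
      with viol[OF J(1)] have "A J \<noteq> 0" by (auto simp: h_def)
      with J show ?thesis by (simp add: J_of) (simp add: h_def)
    qed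
    show "?P \<subset> affine hull ?P \<inter> \<Inter>F'" if F': "F' \<subset> h ` ?N" for F'
    proof -
      from F' obtain J where J: "J \<in> ?N" "h J \<notin> F'" by blast
      from viol[OF J(1)] obtain \<alpha> where \<alpha>: "\<alpha> \<in> ?H" "\<alpha> \<notin> h J" "\<forall>J'\<in>?N. J' \<noteq> J \<longrightarrow> \<alpha> \<in> h J'"
        by blast
      have "\<alpha> \<in> S" if S: "S \<in> F'" for S
      proof -
        from S F' obtain J' where "J' \<in> ?N" "S = h J'" by blast
        with S J(2) \<alpha>(3) show ?thesis by metis
      qed
      with \<alpha>(1) have "\<alpha> \<in> ?H \<inter> \<Inter>F'" by simp
      moreover have "\<alpha> \<notin> ?P" using \<alpha>(2) J(1) unfolding P by simp metis
      moreover have "?P \<subseteq> ?H \<inter> \<Inter>F'" unfolding P using F' by (intro Int_mono Inter_anti_mono) auto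
      ultimately show ?thesis unfolding hull by (metis psubsetI)
    qed
  qed
  define facet where "facet J = ?P \<inter> {\<alpha>. ?g J \<alpha> = -1}" for J
  have "A J \<bullet> \<alpha> = 1 \<longleftrightarrow> ?g J \<alpha> = -1" for J \<alpha> unfolding A by linarith
  then have "{F. F facet_of ?P} = facet ` ?N"
    unfolding facets facet_def using J_of by auto
  moreover have "inj_on facet ?N"
  proof
    fix J J' assume J: "J \<in> ?N" "J' \<in> ?N" "facet J = facet J'"
    obtain \<alpha> where \<alpha>: "\<alpha> \<in> ?H" "?g J \<alpha> = -1" "\<And>K. K \<in> ?N \<Longrightarrow> K \<noteq> J \<Longrightarrow> -1 < ?g K \<alpha>"
      using exists_exposing_point[OF assms J(1)] by blast
    then have "\<alpha> \<in> facet J"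
      by (force simp: facet_def Pi_polyhedron_eq)
    with J have "?g J' \<alpha> = -1" by (simp add: facet_def)
    with \<alpha>(3)[OF J(2)] show "J = J'" by force
  qed
  ultimately show ?thesis by (simp add: card_image)
qed

section \<open>Interior lattice points\<close>

text \<open>
  A point with \<open>\<gamma>\<^sub>J = -1\<close> is not interior, because multiplying it by any factor above 1
  leaves the polyhedron.
\<close>
lemma interior_Pi_polyhedron:
  fixes \<rho> :: "nat \<Rightarrow> 'r::finite" and \<kappa> :: "nat \<Rightarrow> 'c::finite"
  shows "(top_of_set (zero_row_space k n \<rho> \<kappa>)) interior_of Pi_polyhedron k n \<rho> \<kappa> =
    {\<alpha> \<in> zero_row_space k n \<rho> \<kappa>. \<forall>J\<in>nonfrozen_subsets k n. - 1 < gamma k \<rho> \<kappa> J \<alpha>}"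
    (is "?I = ?S")
proof
  let ?N = "nonfrozen_subsets k n" and ?H = "zero_row_space k n \<rho> \<kappa>"
    and ?P = "Pi_polyhedron k n \<rho> \<kappa>" and ?g = "gamma k \<rho> \<kappa>"
  have "open (\<Inter>J\<in>?N. {\<alpha>. - 1 < ?g J \<alpha>})"
    by (intro open_INT finite_nonfrozen_subsets ballI open_Collect_less continuous_intros
        linear_continuous_on linear_linear[THEN iffD2] linear_gamma)
  then have "openin (top_of_set ?H) (?H \<inter> (\<Inter>J\<in>?N. {\<alpha>. - 1 < ?g J \<alpha>}))"
    by (rule openin_open_Int)
  moreover have "?S = ?H \<inter> (\<Inter>J\<in>?N. {\<alpha>. - 1 < ?g J \<alpha>})" by auto
  ultimately have "openin (top_of_set ?H) ?S" by simp
  then show "?S \<subseteq> ?I"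
    by (intro interior_of_maximal) (auto simp: Pi_polyhedron_eq intro: less_imp_le)
  show "?I \<subseteq> ?S"
  proof
    fix \<alpha> assume "\<alpha> \<in> ?I"
    then obtain U where U: "open U" "\<alpha> \<in> U" "\<alpha> \<in> ?H" "?H \<inter> U \<subseteq> ?P"
      by (auto simp: interior_of_def openin_open)
    have "((\<lambda>t. t *\<^sub>R \<alpha>) \<longlongrightarrow> 1 *\<^sub>R \<alpha>) (at_right (1::real))"
      by (intro tendsto_intros)
    then have "\<forall>\<^sub>F t in at_right (1::real). t *\<^sub>R \<alpha> \<in> U"
      using U by (intro topological_tendstoD) auto
    moreover have "\<forall>\<^sub>F t in at_right (1::real). 1 < t"
      by (rule eventually_at_right_less)
    ultimately have "\<forall>\<^sub>F t in at_right (1::real). 1 < t \<and> t *\<^sub>R \<alpha> \<in> U"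
      by eventually_elim blast
    then obtain t :: real where t: "1 < t" "t *\<^sub>R \<alpha> \<in> U"
      using eventually_happens'[OF trivial_limit_at_right_real] by blast
    have "t *\<^sub>R \<alpha> \<in> ?H"
      using subspace_zero_row_space U(3) by (rule subspace_scale)
    with t U have "t *\<^sub>R \<alpha> \<in> ?P" by blast
    then have ge: "- 1 \<le> t * ?g J \<alpha>" if "J \<in> ?N" for J
      using that linear_scale[OF linear_gamma, of k \<rho> \<kappa> J t \<alpha>] by (auto simp: Pi_polyhedron_eq)
    have "- 1 < ?g J \<alpha>" if "J \<in> ?N" for J
    proof (rule ccontr)
      assume "\<not> - 1 < ?g J \<alpha>"
      then have "t * ?g J \<alpha> \<le> t * - 1" using t by (intro mult_left_mono) auto
      with ge[OF that] t show False by linarith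
    qed
    with U show "\<alpha> \<in> ?S" by blast
  qed
qed

text \<open>
  The set \<open>J = {j..j+k} - {j+i}\<close> has the sequence that jumps from \<open>j-1\<close> to \<open>j\<close> after position \<open>i\<close>,
  so it selects the single cell \<open>(i, j)\<close>. One steps out of it at \<open>j+i-1\<close> and at \<open>j+k\<close>; the latter
  uses \<open>k + 2 \<le> n\<close>, as otherwise the cyclic successor of \<open>j+k\<close> would be \<open>j\<close>.
\<close>
lemma exists_nonfrozen_single_entry:
  fixes \<rho> :: "nat \<Rightarrow> 'r::finite" and \<kappa> :: "nat \<Rightarrow> 'c::finite"
  assumes kn: "k + 2 \<le> n" and i: "i \<in> {1..k-1}" and j: "j \<in> {1..n-k}"
  shows "\<exists>J\<in>nonfrozen_subsets k n. \<forall>\<alpha>. gamma k \<rho> \<kappa> J \<alpha> = \<alpha> $ \<rho> i $ \<kappa> j"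
proof -
  define f where "f x = (if x \<le> i then j - 1 else j) + x" for x
  define J where "J = f ` {1..k}"
  have f_less: "f a < f b" if "a < b" for a b using that by (auto simp: f_def)
  have J: "J \<subseteq> {1..n}" "card J = k"
  proof -
    show "J \<subseteq> {1..n}" using i j by (auto simp: J_def f_def split: if_splits)
    have "inj_on f {1..k}" using f_less by (intro linorder_inj_onI) (auto simp: less_imp_neq)
    then show "card J = k" by (simp add: J_def card_image)
  qed
  have shift: "shift J x = (if x \<le> i then j - 1 else j)" if "x \<in> {1..k}" for x
    using nth_elem_image[of k f x] f_less that by (simp add: shift_def J_def f_def)
  have "\<not> frozen k n J"
  proof
    assume "frozen k n J"
    then obtain a where a: "J = cyclic_interval k n a" by (auto simp: frozen_iff)
    have last: "x = (a - 1 + (k - 1)) mod n + 1" if "x \<in> J" "x mod n + 1 \<notin> J" for x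
      using that cyclic_interval_last[of k n x a] kn i by (auto simp: a)
    have mem: "x \<in> J \<longleftrightarrow> j \<le> x \<and> x \<le> j + k \<and> x \<noteq> j + i" for x
    proof
      assume "j \<le> x \<and> x \<le> j + k \<and> x \<noteq> j + i"
      then have "x = f (if x < j + i then x - j + 1 else x - j)"
        "(if x < j + i then x - j + 1 else x - j) \<in> {1..k}"
        using i j by (auto simp: f_def)
      then show "x \<in> J" unfolding J_def by blast
    qed (use i j in \<open>auto simp: J_def f_def split: if_splits\<close>)
    have "j + i - 1 = (a - 1 + (k - 1)) mod n + 1"
      using i j kn by (intro last) (auto simp: mem)
    moreover have "j + k = (a - 1 + (k - 1)) mod n + 1"
      using i j kn by (cases "j + k = n"; intro last) (auto simp: mem)
    ultimately show False using i by auto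
  qed
  with J have "J \<in> nonfrozen_subsets k n" by (simp add: nonfrozen_subsets_def)
  moreover have "gamma k \<rho> \<kappa> J \<alpha> = \<alpha> $ \<rho> i $ \<kappa> j" for \<alpha>
  proof -
    have strip: "strip k n J x = (if x = i then {j} else {})" if "x \<in> {1..k-1}" for x
      using that shift[of x] shift[of "Suc x"] i j by (auto simp: strip_def split: if_splits)
    have "gamma k \<rho> \<kappa> J \<alpha> = (\<Sum>x=1..k-1. if x = i then \<alpha> $ \<rho> i $ \<kappa> j else 0)"
      unfolding gamma_eq_sum_strips[OF J] by (intro sum.cong) (auto simp: strip)
    then show ?thesis using i by simp
  qed
  ultimately show ?thesis by blast
qed

theorem proposition10p12:
  fixes k n :: nat
    and \<rho> :: "nat \<Rightarrow> 'r::finite" and \<kappa> :: "nat \<Rightarrow> 'c::finite"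
  assumes "2 \<le> k" and "k + 2 \<le> n"
    and "bij_betw \<rho> {1..k-1} UNIV" and "bij_betw \<kappa> {1..n-k} UNIV"
  shows "card {F. F facet_of Pi_polyhedron k n \<rho> \<kappa>} = (n choose k) - n \<and>
         (top_of_set (zero_row_space k n \<rho> \<kappa>)) interior_of Pi_polyhedron k n \<rho> \<kappa>
           \<inter> lattice_points k n \<rho> \<kappa> = {\<chi> a b. 0}"
proof
  have kn: "1 \<le> k" "k < n" using assms by auto
  show "card {F. F facet_of Pi_polyhedron k n \<rho> \<kappa>} = (n choose k) - n"
    using card_facets[OF kn bij_betw_imp_inj_on bij_betw_imp_inj_on, OF assms(3,4)]
      card_nonfrozen_subsets[OF kn] by simp
  have zero: "(\<chi> a b. 0) = (0 :: real ^ 'c ^ 'r)" by (simp add: vec_eq_iff)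
  have "\<alpha> = 0"
    if "\<alpha> \<in> (top_of_set (zero_row_space k n \<rho> \<kappa>)) interior_of Pi_polyhedron k n \<rho> \<kappa>"
      and lat: "\<alpha> \<in> lattice_points k n \<rho> \<kappa>" for \<alpha> :: "real ^ 'c ^ 'r"
  proof -
    from that have int: "\<And>J. J \<in> nonfrozen_subsets k n \<Longrightarrow> - 1 < gamma k \<rho> \<kappa> J \<alpha>"
      unfolding interior_Pi_polyhedron by blast
    have nonneg: "0 \<le> \<alpha> $ \<rho> i $ \<kappa> j" if ij: "i \<in> {1..k-1}" "j \<in> {1..n-k}" for i j
    proof -
      have "- 1 < \<alpha> $ \<rho> i $ \<kappa> j"
        using exists_nonfrozen_single_entry[OF assms(2) ij, of \<rho> \<kappa>] int by metis
      moreover have "\<alpha> $ \<rho> i $ \<kappa> j \<in> \<int>"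
        using lat ij by (auto simp: lattice_points_def)
      ultimately show ?thesis by (auto elim!: Ints_cases)
    qed
    have "\<alpha> $ \<rho> i $ \<kappa> j = 0" if ij: "i \<in> {1..k-1}" "j \<in> {1..n-k}" for i j
    proof -
      have "(\<Sum>j = 1..n-k. \<alpha> $ \<rho> i $ \<kappa> j) = 0"
        using lat ij by (auto simp: lattice_points_def zero_row_space_def)
      then show ?thesis
        using nonneg[OF ij(1)] ij(2) by (subst (asm) sum_nonneg_eq_0_iff) auto
    qed
    moreover have "\<exists>i\<in>{1..k-1}. r = \<rho> i" "\<exists>j\<in>{1..n-k}. c = \<kappa> j" for r c
      using assms(3,4) by (auto simp: bij_betw_def set_eq_iff image_iff)
    ultimately have "\<alpha> $ r $ c = 0" for r c by metis
    then show ?thesis by (simp add: vec_eq_iff)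
  qed
  moreover have "0 \<in> (top_of_set (zero_row_space k n \<rho> \<kappa>)) interior_of Pi_polyhedron k n \<rho> \<kappa>"
    unfolding interior_Pi_polyhedron
    using linear_0[OF linear_gamma, of k \<rho> \<kappa>] by (auto simp: zero_row_space_def)
  moreover have "0 \<in> lattice_points k n \<rho> \<kappa>"
    by (auto simp: lattice_points_def zero_row_space_def)
  ultimately show "(top_of_set (zero_row_space k n \<rho> \<kappa>)) interior_of Pi_polyhedron k n \<rho> \<kappa>
           \<inter> lattice_points k n \<rho> \<kappa> = {\<chi> a b. 0}"
    unfolding zero by blast
qed

end
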